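(* There is a sequence of tropical polynomials $r_1(x),r_2(x),\dots,r_n(x),\dots$ of one variable such that $r_n$ is computable by a tropical circuit of size $O(n)$ and $r_n(x)$ has at least $2^n$ roots.
   Context: $\mathbb{K}$ is $\mathbb{R}$ or $\mathbb{Q}$, with tropical addition $x\oplus y=\max(x,y)$ and tropical multiplication $x\odot y=x+y$. A tropical polynomial of one variable is a finite nonempty collection of tropical monomials $c_i+i x$ with distinct nonnegative integer exponents $i$ and constants $c_i\in\mathbb{K}$, with value the maximum of its monomials (monomials with the same exponent are merged by taking the maximal constant). A point $a\in\mathbb{K}$ is a root if the maximum at $a$ is attained on at least two distinct monomials; equivalently, $a$ is a point of non-smoothness of the piecewise linear convex function. A tropical circuit is a directed acyclic graph each vertex (gate) of which has in-degree $0$ or $2$; gates of in-degree $0$ are labeled by a variable or a constant of $\mathbb{K}$, gates of in-degree $2$ are labeled by $\oplus$ or $\odot$. Each gate computes a tropical polynomial defined inductively in the natural way; one gate is the output gate, and the circuit computes the polynomial of the output gate. The size of the circuit is the number of gates. The constant in $O(n)$ is absolute. *)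

theory Defs
  imports Complex_Main "Graph_Theory.Digraph"
begin

text \<open>
  A tropical polynomial is kept as a formal object, not as the function it induces:
  the value \<^term>\<open>Some c\<close> at \<open>i\<close> stands for the monomial \<open>c + i x\<close>, and
  \<^term>\<open>None\<close> says that no monomial with exponent \<open>i\<close> is present.
\<close>

typedef 'a trop_poly = "{p :: nat \<Rightarrow> 'a option. finite (dom p) \<and> dom p \<noteq> {}}"
  morphisms mono_coeff Abs_trop_poly
  by (rule exI[of _ "[0 \<mapsto> undefined]"]) simp

setup_lifting type_definition_trop_poly

lift_definition trop_const :: "'a \<Rightarrow> 'a trop_poly" is "\<lambda>c. [0 \<mapsto> c]"
  by simp

lift_definition trop_var :: "'a::zero trop_poly" is "[1 \<mapsto> 0]"
  by simp

lift_definition trop_plus :: "'a::linorder trop_poly \<Rightarrow> 'a trop_poly \<Rightarrow> 'a trop_poly"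
  is "\<lambda>p q i. case p i of None \<Rightarrow> q i
        | Some a \<Rightarrow> (case q i of None \<Rightarrow> Some a | Some b \<Rightarrow> Some (max a b))"
proof -
  fix p q :: "nat \<Rightarrow> 'a option"
  assume "finite (dom p) \<and> dom p \<noteq> {}" and "finite (dom q) \<and> dom q \<noteq> {}"
  moreover have "dom (\<lambda>i. case p i of None \<Rightarrow> q i
        | Some a \<Rightarrow> (case q i of None \<Rightarrow> Some a | Some b \<Rightarrow> Some (max a b))) = dom p \<union> dom q"
    by (auto split: option.splits)
  ultimately show "finite (dom (\<lambda>i. case p i of None \<Rightarrow> q i
        | Some a \<Rightarrow> (case q i of None \<Rightarrow> Some a | Some b \<Rightarrow> Some (max a b)))) \<and>
      dom (\<lambda>i. case p i of None \<Rightarrow> q i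
        | Some a \<Rightarrow> (case q i of None \<Rightarrow> Some a | Some b \<Rightarrow> Some (max a b))) \<noteq> {}"
    by auto
qed

definition prod_coeffs ::
  "(nat \<Rightarrow> 'a::plus option) \<Rightarrow> (nat \<Rightarrow> 'a option) \<Rightarrow> nat \<Rightarrow> 'a set" where
  "prod_coeffs p q k = {a + b |a b. \<exists>i j. i + j = k \<and> p i = Some a \<and> q j = Some b}"

lift_definition trop_times ::
  "'a::{plus,linorder} trop_poly \<Rightarrow> 'a trop_poly \<Rightarrow> 'a trop_poly"
  is "\<lambda>p q k. if prod_coeffs p q k = {} then None else Some (Max (prod_coeffs p q k))"
proof -
  fix p q :: "nat \<Rightarrow> 'a option"
  assume pq: "finite (dom p) \<and> dom p \<noteq> {}" "finite (dom q) \<and> dom q \<noteq> {}"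
  let ?r = "\<lambda>k. if prod_coeffs p q k = {} then None else Some (Max (prod_coeffs p q k))"
  have "dom ?r = (\<lambda>(i, j). i + j) ` (dom p \<times> dom q)"
  proof (intro set_eqI)
    fix k
    have "k \<in> dom ?r \<longleftrightarrow> prod_coeffs p q k \<noteq> {}"
      by (simp add: dom_def)
    also have "\<dots> \<longleftrightarrow> k \<in> (\<lambda>(i, j). i + j) ` (dom p \<times> dom q)"
      by (auto simp: prod_coeffs_def image_iff dom_def)
    finally show "k \<in> dom ?r \<longleftrightarrow> k \<in> (\<lambda>(i, j). i + j) ` (dom p \<times> dom q)" .
  qed
  then show "finite (dom ?r) \<and> dom ?r \<noteq> {}"
    using pq by (simp only: finite_imageI finite_cartesian_product image_is_empty Times_empty) simp
qed

definition trop_eval :: "'a::linordered_field trop_poly \<Rightarrow> 'a \<Rightarrow> 'a" where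
  "trop_eval p x = Max {c + of_nat i * x |i c. mono_coeff p i = Some c}"

definition trop_root :: "'a::linordered_field trop_poly \<Rightarrow> 'a \<Rightarrow> bool" where
  "trop_root p a \<longleftrightarrow> (\<exists>i j c d. i \<noteq> j \<and> mono_coeff p i = Some c \<and> mono_coeff p j = Some d \<and>
     c + of_nat i * a = trop_eval p a \<and> d + of_nat j * a = trop_eval p a)"

datatype 'a gate_label = Var | Const 'a | Plus | Times

record ('a, 'v, 'e) circuit =
  graph :: "('v, 'e) pre_digraph"
  label :: "'v \<Rightarrow> 'a gate_label"
  out :: 'v

text \<open>
  Parallel arcs are allowed, so that both inputs of a gate may come from the same gate.
  The inputs of a gate are unordered; this is harmless as both operations are commutative.
\<close>

locale trop_circuit =
  fixes C :: "('a, 'v, 'e) circuit"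
  assumes fin_digraph: "fin_digraph (graph C)"
    and acyclic: "acyclic (arcs_ends (graph C))"
    and labels: "v \<in> verts (graph C) \<Longrightarrow>
      (in_degree (graph C) v = 0 \<and> (label C v = Var \<or> (\<exists>c. label C v = Const c))) \<or>
      (in_degree (graph C) v = 2 \<and> (label C v = Plus \<or> label C v = Times))"
    and out: "out C \<in> verts (graph C)"

definition circuit_size :: "('a, 'v, 'e) circuit \<Rightarrow> nat" where
  "circuit_size C = card (verts (graph C))"

inductive gate_computes ::
  "('a::linordered_field, 'v, 'e) circuit \<Rightarrow> 'v \<Rightarrow> 'a trop_poly \<Rightarrow> bool"
  for C where
  var: "v \<in> verts (graph C) \<Longrightarrow> label C v = Var \<Longrightarrow> gate_computes C v trop_var"
| const: "v \<in> verts (graph C) \<Longrightarrow> label C v = Const c \<Longrightarrow> gate_computes C v (trop_const c)"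
| plus: "v \<in> verts (graph C) \<Longrightarrow> label C v = Plus \<Longrightarrow>
    in_arcs (graph C) v = {e, f} \<Longrightarrow> e \<noteq> f \<Longrightarrow>
    gate_computes C (tail (graph C) e) p \<Longrightarrow> gate_computes C (tail (graph C) f) q \<Longrightarrow>
    gate_computes C v (trop_plus p q)"
| times: "v \<in> verts (graph C) \<Longrightarrow> label C v = Times \<Longrightarrow>
    in_arcs (graph C) v = {e, f} \<Longrightarrow> e \<noteq> f \<Longrightarrow>
    gate_computes C (tail (graph C) e) p \<Longrightarrow> gate_computes C (tail (graph C) f) q \<Longrightarrow>
    gate_computes C v (trop_times p q)"

lemma trop_plus_commute: "trop_plus p q = trop_plus q p"
  by transfer (auto simp: fun_eq_iff max.commute split: option.splits)

lemma trop_times_commute: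
  fixes p q :: "'a::linordered_field trop_poly"
  shows "trop_times p q = trop_times q p"
proof -
  have "prod_coeffs p q k = prod_coeffs q p k" for p q :: "nat \<Rightarrow> 'a option" and k
  proof -
    have "prod_coeffs p q k \<subseteq> prod_coeffs q p k" for p q :: "nat \<Rightarrow> 'a option"
    proof
      fix x assume "x \<in> prod_coeffs p q k"
      then obtain i j a b where "x = b + a" "j + i = k" "p i = Some a" "q j = Some b"
        by (auto simp: prod_coeffs_def add.commute)
      then show "x \<in> prod_coeffs q p k"
        unfolding prod_coeffs_def by blast
    qed
    then show ?thesis by blast
  qed
  then have "prod_coeffs (mono_coeff p) (mono_coeff q) = prod_coeffs (mono_coeff q) (mono_coeff p)"
    by blast
  then show ?thesis
    unfolding trop_times_def map_fun_def comp_def id_def by (simp only:)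
qed

lemma gate_computes_unique:
  "gate_computes C v p \<Longrightarrow> gate_computes C v q \<Longrightarrow> p = q"
proof (induction arbitrary: q rule: gate_computes.induct)
  case (var v)
  from var(3) var(1,2) show ?case by cases auto
next
  case (const v c)
  from const(3) const(1,2) show ?case by cases auto
next
  case (plus v e f p q r)
  note IH = plus.IH
  have l: "label C v = Plus" and ef: "in_arcs (graph C) v = {e, f}"
    by fact+
  from plus.prems show ?case
  proof cases
    case (plus e' f' p' q')
    from ef plus(4) have "e' = e \<and> f' = f \<or> e' = f \<and> f' = e"
      by (metis doubleton_eq_iff)
    then show ?thesis
    proof (elim disjE conjE)
      assume "e' = e" "f' = f"
      with plus have "p = p'" "q = q'" using IH by simp_all
      with plus show ?thesis by simp
    next
      assume "e' = f" "f' = e"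
      with plus have "p = q'" "q = p'" using IH by simp_all
      with plus show ?thesis by (simp add: trop_plus_commute)
    qed
  qed (simp_all add: l)
next
  case (times v e f p q r)
  note IH = times.IH
  have l: "label C v = Times" and ef: "in_arcs (graph C) v = {e, f}"
    by fact+
  from times.prems show ?case
  proof cases
    case (times e' f' p' q')
    from ef times(4) have "e' = e \<and> f' = f \<or> e' = f \<and> f' = e"
      by (metis doubleton_eq_iff)
    then show ?thesis
    proof (elim disjE conjE)
      assume "e' = e" "f' = f"
      with times have "p = p'" "q = q'" using IH by simp_all
      with times show ?thesis by simp
    next
      assume "e' = f" "f' = e"
      with times have "p = q'" "q = p'" using IH by simp_all
      with times show ?thesis by (simp add: trop_times_commute)
    qed
  qed (simp_all add: l)
qed

lemma gate_computes_total:
  fixes C :: "('a::linordered_field, 'v, 'e) circuit"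
  assumes "trop_circuit C" and "v \<in> verts (graph C)"
  shows "\<exists>p. gate_computes C v p"
proof -
  interpret trop_circuit C by fact
  interpret G: fin_digraph "graph C" by (rule fin_digraph)
  have "wf (arcs_ends (graph C))"
  proof (rule finite_acyclic_wf)
    show "finite (arcs_ends (graph C))"
      by (simp add: arcs_ends_def)
  qed (rule acyclic)
  then show ?thesis
    using assms(2)
  proof (induction v rule: wf_induct_rule)
    case (less v)
    have pred: "\<exists>p. gate_computes C (tail (graph C) e) p" if "e \<in> in_arcs (graph C) v" for e
    proof (rule less.IH)
      show "(tail (graph C) e, v) \<in> arcs_ends (graph C)"
        using that by (auto simp: arcs_ends_conv)
      show "tail (graph C) e \<in> verts (graph C)"
        using that by simp
    qed
    from labels[OF less.prems] show ?case
    proof (elim disjE conjE exE)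
      assume l: "in_degree (graph C) v = 2" "label C v = Plus"
      then obtain e f where "in_arcs (graph C) v = {e, f}" "e \<noteq> f"
        by (auto simp: in_degree_def card_2_iff)
      moreover from this pred obtain p q where
        "gate_computes C (tail (graph C) e) p" "gate_computes C (tail (graph C) f) q"
        by (metis insertI1 insertI2)
      ultimately show ?thesis
        using gate_computes.plus[OF less.prems l(2)] by blast
    next
      assume l: "in_degree (graph C) v = 2" "label C v = Times"
      then obtain e f where "in_arcs (graph C) v = {e, f}" "e \<noteq> f"
        by (auto simp: in_degree_def card_2_iff)
      moreover from this pred obtain p q where
        "gate_computes C (tail (graph C) e) p" "gate_computes C (tail (graph C) f) q"
        by (metis insertI1 insertI2)
      ultimately show ?thesis
        using gate_computes.times[OF less.prems l(2)] by blast
    qed (use less.prems in \<open>auto intro: gate_computes.var gate_computes.const\<close>)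
  qed
qed

definition computes :: "('a::linordered_field, 'v, 'e) circuit \<Rightarrow> 'a trop_poly \<Rightarrow> bool" where
  "computes C p \<longleftrightarrow> gate_computes C (out C) p"

definition computable_in_size :: "'a::linordered_field trop_poly \<Rightarrow> nat \<Rightarrow> bool" where
  "computable_in_size p s \<longleftrightarrow>
     (\<exists>C :: ('a, nat, nat) circuit. trop_circuit C \<and> circuit_size C \<le> s \<and> computes C p)"

end

theory Submission
  imports Defs
begin

text \<open>
  The tent map \<open>T x = 2 \<bar>x\<bar> - 1\<close> sends each of \<open>(-1, 0)\<close> and \<open>(0, 1)\<close> bijectively onto
  \<open>(-1, 1)\<close>, so its \<open>n\<close>-th iterate is a sawtooth with \<open>2 ^ n\<close> zeros
  (\<open>card_tent_zeros\<close>). This sawtooth is far from convex and hence is not the function of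
  a tropical polynomial, but it is, up to scaling, a difference \<open>A - B\<close> of two of them,
  that is, a tropical fraction. Fractions iterate cheaply: since
  \<open>\<bar>A - B\<bar> = 2 max(A, B) - (A + B)\<close>, one application of the tent map replaces \<open>A\<close> by
  \<open>(A \<oplus> B) \<odot> (A \<oplus> B)\<close> and \<open>B\<close> by \<open>A \<odot> B\<close> plus a constant, at the price of five gates
  (\<open>eval_sawtooth\<close>, \<open>sawtooth_program\<close>).

  The zeros of the fraction become roots of \<open>A \<oplus> B\<close>. At a zero \<open>a\<close> both \<open>A\<close> and \<open>B\<close> attain
  the value of \<open>A \<oplus> B\<close>. If \<open>a\<close> were not a root, they would attain it by the same
  single monomial, this monomial would keep dominating both of them on an interval, and
  \<open>A - B\<close> would vanish on that interval, whereas it has only finitely many zeros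
  (\<open>root_of_trop_plus\<close>).
\<close>

section \<open>Values of tropical polynomials\<close>

context
  fixes p :: "'a::linordered_field trop_poly" and x :: 'a
begin

lemma finite_dom_mono_coeff: "finite (dom (mono_coeff p))"
  using mono_coeff[of p] by simp

lemma finite_values: "finite {c + of_nat i * x |i c. mono_coeff p i = Some c}"
proof -
  have "{c + of_nat i * x |i c. mono_coeff p i = Some c}
      = (\<lambda>i. the (mono_coeff p i) + of_nat i * x) ` dom (mono_coeff p)"
    by force
  then show ?thesis
    using finite_dom_mono_coeff by simp
qed

lemma monomial_le_eval:
  "mono_coeff p i = Some c \<Longrightarrow> c + of_nat i * x \<le> trop_eval p x"
  unfolding trop_eval_def by (rule Max_ge[OF finite_values]) blast

lemma eval_attained:
  obtains i c where "mono_coeff p i = Some c" "c + of_nat i * x = trop_eval p x"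
proof -
  have "{c + of_nat i * x |i c. mono_coeff p i = Some c} \<noteq> {}"
    using mono_coeff[of p] by (force simp: dom_def)
  from Max_in[OF finite_values this] show thesis
    using that unfolding trop_eval_def by force
qed

lemma eval_eqI:
  assumes "mono_coeff p i = Some c" and "c + of_nat i * x = v"
    and "\<And>j d. mono_coeff p j = Some d \<Longrightarrow> d + of_nat j * x \<le> v"
  shows "trop_eval p x = v"
  using assms monomial_le_eval eval_attained by (metis antisym)

end

lemma eval_trop_var: "trop_eval trop_var x = x"
  by (rule eval_eqI[where i = 1 and c = 0]) (auto simp: trop_var.rep_eq split: if_splits)

lemma eval_trop_const: "trop_eval (trop_const c) x = c"
  by (rule eval_eqI[where i = 0 and c = c]) (auto simp: trop_const.rep_eq split: if_splits)

lemma mono_coeff_trop_plus_left: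
  assumes "mono_coeff p i = Some c"
  obtains d where "mono_coeff (trop_plus p q) i = Some d" "c \<le> d"
  using assms by (cases "mono_coeff q i") (auto simp: trop_plus.rep_eq)

lemma eval_trop_plus_ge: "trop_eval p x \<le> trop_eval (trop_plus p q) x"
proof -
  obtain i c where c: "mono_coeff p i = Some c" "c + of_nat i * x = trop_eval p x"
    by (rule eval_attained)
  obtain d where "mono_coeff (trop_plus p q) i = Some d" "c \<le> d"
    by (rule mono_coeff_trop_plus_left[OF c(1)])
  then show ?thesis
    using c(2) monomial_le_eval[of "trop_plus p q" i d x] by (simp flip: c(2))
qed

lemma eval_trop_plus: "trop_eval (trop_plus p q) x = max (trop_eval p x) (trop_eval q x)"
proof (rule antisym)
  obtain i c where c: "mono_coeff (trop_plus p q) i = Some c"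
    "c + of_nat i * x = trop_eval (trop_plus p q) x"
    by (rule eval_attained)
  then have "mono_coeff p i = Some c \<or> mono_coeff q i = Some c"
    by (auto simp: trop_plus.rep_eq max_def split: option.splits if_splits)
  then show "trop_eval (trop_plus p q) x \<le> max (trop_eval p x) (trop_eval q x)"
    using monomial_le_eval[of p i c x] monomial_le_eval[of q i c x] c(2) by auto
  show "max (trop_eval p x) (trop_eval q x) \<le> trop_eval (trop_plus p q) x"
    using eval_trop_plus_ge[of p x q] eval_trop_plus_ge[of q x p]
    by (simp add: trop_plus_commute)
qed

lemma finite_prod_coeffs:
  "finite (prod_coeffs (mono_coeff p) (mono_coeff (q :: 'a::linordered_field trop_poly)) k)"
proof -
  have "prod_coeffs (mono_coeff p) (mono_coeff q) k
      \<subseteq> (\<lambda>(i, j). the (mono_coeff p i) + the (mono_coeff q j)) `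
        (dom (mono_coeff p) \<times> dom (mono_coeff q))"
    by (force simp: prod_coeffs_def)
  then show ?thesis
    by (rule finite_subset) (simp add: finite_dom_mono_coeff)
qed

lemma eval_trop_times: "trop_eval (trop_times p q) x = trop_eval p x + trop_eval q x"
proof (rule antisym)
  obtain k c where c: "mono_coeff (trop_times p q) k = Some c"
    "c + of_nat k * x = trop_eval (trop_times p q) x"
    by (rule eval_attained)
  then have "c \<in> prod_coeffs (mono_coeff p) (mono_coeff q) k"
    using Max_in[OF finite_prod_coeffs] by (auto simp: trop_times.rep_eq split: if_splits)
  then obtain i j a b where "c = a + b" "i + j = k" "mono_coeff p i = Some a" "mono_coeff q j = Some b"
    by (auto simp: prod_coeffs_def)
  moreover from this have "a + of_nat i * x \<le> trop_eval p x" "b + of_nat j * x \<le> trop_eval q x"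
    by (simp_all add: monomial_le_eval)
  ultimately show "trop_eval (trop_times p q) x \<le> trop_eval p x + trop_eval q x"
    unfolding c(2)[symmetric] by (auto simp: algebra_simps)
next
  obtain i a where a: "mono_coeff p i = Some a" "a + of_nat i * x = trop_eval p x"
    by (rule eval_attained)
  obtain j b where b: "mono_coeff q j = Some b" "b + of_nat j * x = trop_eval q x"
    by (rule eval_attained)
  let ?S = "prod_coeffs (mono_coeff p) (mono_coeff q) (i + j)"
  have ab: "a + b \<in> ?S"
    using a b by (auto simp: prod_coeffs_def)
  then have "mono_coeff (trop_times p q) (i + j) = Some (Max ?S)"
    by (auto simp: trop_times.rep_eq)
  then have "Max ?S + of_nat (i + j) * x \<le> trop_eval (trop_times p q) x"
    by (rule monomial_le_eval)
  moreover have "a + b \<le> Max ?S"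
    using ab by (simp add: finite_prod_coeffs)
  ultimately show "trop_eval p x + trop_eval q x \<le> trop_eval (trop_times p q) x"
    using a(2) b(2) by (simp add: algebra_simps flip: a(2) b(2))
qed

section \<open>Roots\<close>

text \<open>Two monomials of different slope meet in a single point, so a root is determined by
  any two exponents attaining the maximum there.\<close>

lemma finite_roots: "finite {a. trop_root p a}"
proof -
  have "{a. trop_root p a}
      \<subseteq> (\<lambda>(i, j). (the (mono_coeff p j) - the (mono_coeff p i)) / (of_nat i - of_nat j)) `
        (dom (mono_coeff p) \<times> dom (mono_coeff p))"
  proof
    fix a assume "a \<in> {a. trop_root p a}"
    then obtain i j c d where ij: "i \<noteq> j" "mono_coeff p i = Some c" "mono_coeff p j = Some d"
      "c + of_nat i * a = d + of_nat j * a"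
      unfolding trop_root_def by auto
    then have "a = (d - c) / (of_nat i - of_nat j)"
      by (simp add: field_simps)
    with ij show "a \<in> (\<lambda>(i, j). (the (mono_coeff p j) - the (mono_coeff p i)) / (of_nat i - of_nat j)) `
        (dom (mono_coeff p) \<times> dom (mono_coeff p))"
      by (intro image_eqI[where x = "(i, j)"]) auto
  qed
  then show ?thesis
    by (rule finite_subset) (simp add: finite_dom_mono_coeff)
qed

text \<open>A monomial that alone attains the maximum at \<open>a\<close> stays maximal to the right of \<open>a\<close>
  until the first of the finitely many points at which a steeper monomial catches up.\<close>

lemma dominant_monomial_right:
  fixes p :: "'a::linordered_field trop_poly"
  assumes i: "mono_coeff p i = Some c" "c + of_nat i * a = trop_eval p a"
    and nonroot: "\<not> trop_root p a"
  obtains b where "a < b" "\<And>x. a \<le> x \<Longrightarrow> x \<le> b \<Longrightarrow> trop_eval p x = c + of_nat i * x"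
proof -
  (* The crossing points with steeper monomials; a + 1 serves if there are none. *)
  define X where "X = insert (a + 1)
    ((\<lambda>j. (c - the (mono_coeff p j)) / (of_nat j - of_nat i)) ` {j \<in> dom (mono_coeff p). i < j})"
  have fin: "finite X"
    by (simp add: X_def finite_dom_mono_coeff)
  have below: "d + of_nat j * a < c + of_nat i * a" if "mono_coeff p j = Some d" "j \<noteq> i" for j d
    using that i nonroot monomial_le_eval[of p j d a] unfolding trop_root_def by force
  have "\<forall>x \<in> X. a < x"
    using below by (auto simp: X_def field_simps)
  then have gt: "a < Min X"
    using fin by (simp add: X_def)
  have "trop_eval p x = c + of_nat i * x" if x: "a \<le> x" "x \<le> Min X" for x
  proof (rule eval_eqI[OF i(1) refl])
    fix j d assume j: "mono_coeff p j = Some d"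
    consider "j = i" | "j < i" | "i < j" by linarith
    then show "d + of_nat j * x \<le> c + of_nat i * x"
    proof cases
      case 1
      then show ?thesis using j i by simp
    next
      case 2
      then have "(of_nat j - of_nat i) * (x - a) \<le> 0"
        using x by (intro mult_nonpos_nonneg) auto
      then show ?thesis
        using below[OF j] 2 by (simp add: algebra_simps)
    next
      case 3
      then have "(c - d) / (of_nat j - of_nat i) \<in> X"
        unfolding X_def using j by (intro insertI2 image_eqI[where x = j]) auto
      then have "x \<le> (c - d) / (of_nat j - of_nat i)"
        using x(2) fin by (meson Min_le order_trans)
      then show ?thesis
        using 3 by (simp add: field_simps)
    qed
  qed
  with gt that show thesis by blast
qed

lemma attained_in_trop_plus:
  assumes "mono_coeff p i = Some c" "c + of_nat i * a = trop_eval p a"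
    and "trop_eval q a \<le> trop_eval p a"
  shows "\<exists>d. mono_coeff (trop_plus p q) i = Some d \<and>
    d + of_nat i * a = trop_eval (trop_plus p q) a"
proof -
  obtain d where d: "mono_coeff (trop_plus p q) i = Some d" "c \<le> d"
    by (rule mono_coeff_trop_plus_left[OF assms(1)])
  have "d + of_nat i * a \<le> trop_eval (trop_plus p q) a"
    using d(1) by (rule monomial_le_eval)
  moreover have "trop_eval (trop_plus p q) a = c + of_nat i * a"
    using assms(2,3) by (simp add: eval_trop_plus)
  ultimately show ?thesis
    using d by auto
qed

lemma trop_root_trop_plus_left:
  assumes "trop_root p a" "trop_eval q a \<le> trop_eval p a"
  shows "trop_root (trop_plus p q) a"
  using assms(1) attained_in_trop_plus[OF _ _ assms(2)] unfolding trop_root_def by metis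

text \<open>Finiteness of the set of common values excludes the one way in which two summands can agree
  at \<open>a\<close> without creating a root, namely that they coincide as functions near \<open>a\<close>.\<close>

lemma root_of_trop_plus:
  fixes p q :: "'a::linordered_field trop_poly"
  assumes fin: "finite {x. trop_eval p x = trop_eval q x}" and eq: "trop_eval p a = trop_eval q a"
  shows "trop_root (trop_plus p q) a"
proof (rule ccontr)
  assume nonroot: "\<not> trop_root (trop_plus p q) a"
  obtain i c where i: "mono_coeff p i = Some c" "c + of_nat i * a = trop_eval p a"
    by (rule eval_attained)
  obtain j d where j: "mono_coeff q j = Some d" "d + of_nat j * a = trop_eval q a"
    by (rule eval_attained)
  have "\<exists>c'. mono_coeff (trop_plus p q) i = Some c' \<and> c' + of_nat i * a = trop_eval (trop_plus p q) a"
    using attained_in_trop_plus[OF i, of q] eq by simp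
  moreover have "\<exists>d'. mono_coeff (trop_plus p q) j = Some d' \<and> d' + of_nat j * a = trop_eval (trop_plus p q) a"
    using attained_in_trop_plus[OF j, of p] eq by (simp add: trop_plus_commute)
  ultimately have ij: "i = j"
    using nonroot unfolding trop_root_def by metis
  then have cd: "c = d"
    using i(2) j(2) eq by simp
  have "\<not> trop_root p a"
    using nonroot trop_root_trop_plus_left[of p a q] eq by auto
  from dominant_monomial_right[OF i this] obtain b
    where b: "a < b" "\<And>x. a \<le> x \<Longrightarrow> x \<le> b \<Longrightarrow> trop_eval p x = c + of_nat i * x" by metis
  have "\<not> trop_root q a"
    using nonroot trop_root_trop_plus_left[of q a p] eq by (auto simp: trop_plus_commute)
  from dominant_monomial_right[OF j this] obtain b'
    where b': "a < b'" "\<And>x. a \<le> x \<Longrightarrow> x \<le> b' \<Longrightarrow> trop_eval q x = d + of_nat j * x" by metis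
  have "{a..min b b'} \<subseteq> {x. trop_eval p x = trop_eval q x}"
    using b(2) b'(2) ij cd by auto
  moreover have "infinite {a..min b b'}"
    using b(1) b'(1) by (simp add: infinite_Icc_iff)
  ultimately show False
    using fin finite_subset by blast
qed

section \<open>Zeros of the iterated tent map\<close>

definition tent :: "'a::linordered_field \<Rightarrow> 'a" where
  "tent x = 2 * \<bar>x\<bar> - 1"

lemma finite_tent_zeros: "finite {x :: 'a::linordered_field. (tent ^^ n) x = 0}"
proof (induction n)
  case (Suc n)
  let ?Z = "{x :: 'a. (tent ^^ n) x = 0}"
  have "{x :: 'a. (tent ^^ Suc n) x = 0} \<subseteq> (\<lambda>t. (t + 1) / 2) ` ?Z \<union> (\<lambda>t. - ((t + 1) / 2)) ` ?Z"
  proof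
    fix x :: 'a assume "x \<in> {x. (tent ^^ Suc n) x = 0}"
    then have "tent x \<in> ?Z"
      by (simp add: funpow_Suc_right del: funpow.simps)
    moreover have "x = (tent x + 1) / 2 \<or> x = - ((tent x + 1) / 2)"
      by (auto simp: tent_def abs_if)
    ultimately show "x \<in> (\<lambda>t. (t + 1) / 2) ` ?Z \<union> (\<lambda>t. - ((t + 1) / 2)) ` ?Z"
      by blast
  qed
  then show ?case
    using Suc finite_subset by blast
qed simp

lemma card_tent_zeros:
  "\<exists>Z :: 'a::linordered_field set. finite Z \<and> card Z = 2 ^ n \<and> Z \<subseteq> {-1<..<1} \<and>
    (\<forall>z \<in> Z. (tent ^^ n) z = 0)"
proof (induction n)
  case 0
  show ?case by (rule exI[of _ "{0}"]) simp
next
  case (Suc n)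
  then obtain Z :: "'a set" where Z: "finite Z" "card Z = 2 ^ n" "Z \<subseteq> {-1<..<1}"
    "\<And>z. z \<in> Z \<Longrightarrow> (tent ^^ n) z = 0" by blast
  (* The two branches of the inverse of the tent map; they have opposite signs on (-1, 1). *)
  define P where "P = (\<lambda>t. (t + 1) / 2) ` Z"
  define N where "N = (\<lambda>t. - ((t + 1) / 2)) ` Z"
  have P: "P \<subseteq> {0<..<1}" and N: "N \<subseteq> {-1<..<0}"
    using Z(3) by (force simp: P_def N_def field_simps)+
  have "P \<inter> N = {}"
    using P N by force
  then have "card (P \<union> N) = card P + card N"
    using Z(1) by (intro card_Un_disjoint) (simp_all add: P_def N_def)
  moreover have "card P = card Z" "card N = card Z"
    unfolding P_def N_def by (auto intro!: card_image inj_onI)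
  ultimately have "card (P \<union> N) = 2 ^ Suc n"
    using Z(2) by simp
  moreover have "(tent ^^ Suc n) z = 0" if "z \<in> P \<union> N" for z
  proof -
    have "tent z \<in> Z"
      using that Z(3) by (force simp: P_def N_def tent_def abs_if field_simps)
    then show ?thesis
      using Z(4) by (simp add: funpow_Suc_right del: funpow.simps)
  qed
  moreover have "P \<union> N \<subseteq> {-1<..<1}"
    using P N by force
  ultimately show ?case
    using Z(1) by (intro exI[of _ "P \<union> N"]) (simp add: P_def N_def)
qed

section \<open>The sawtooth as a tropical fraction\<close>

text \<open>The fraction is kept scaled by \<open>1 / 2 ^ n\<close>, so that
  the factor 2 of the tent map costs no gates: only its constant term is adjusted in each step.\<close>

fun sawtooth_num :: "nat \<Rightarrow> 'a::linordered_field trop_poly"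
  and sawtooth_den :: "nat \<Rightarrow> 'a::linordered_field trop_poly" where
  "sawtooth_num 0 = trop_var"
| "sawtooth_den 0 = trop_const 0"
| "sawtooth_num (Suc n) =
    trop_times (trop_plus (sawtooth_num n) (sawtooth_den n)) (trop_plus (sawtooth_num n) (sawtooth_den n))"
| "sawtooth_den (Suc n) =
    trop_times (trop_times (sawtooth_num n) (sawtooth_den n)) (trop_const (1 / 2 ^ Suc n))"

lemma eval_sawtooth:
  "trop_eval (sawtooth_num n) x - trop_eval (sawtooth_den n) x = (tent ^^ n) x / 2 ^ n"
proof (induction n)
  case 0
  show ?case by (simp add: eval_trop_var eval_trop_const)
next
  case (Suc n)
  let ?A = "trop_eval (sawtooth_num n) x" and ?B = "trop_eval (sawtooth_den n) x"
  have "trop_eval (sawtooth_num (Suc n)) x - trop_eval (sawtooth_den (Suc n)) x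
      = 2 * max ?A ?B - (?A + ?B) - 1 / 2 ^ Suc n"
    by (simp add: eval_trop_times eval_trop_plus eval_trop_const)
  also have "\<dots> = \<bar>?A - ?B\<bar> - 1 / 2 ^ Suc n"
    by (simp add: max_def abs_if)
  also have "\<dots> = (tent ^^ Suc n) x / 2 ^ Suc n"
    by (simp add: Suc tent_def[of "(tent ^^ n) x"] abs_divide field_simps)
  finally show ?case .
qed

lemma card_sawtooth_roots:
  fixes n :: nat
  defines "r \<equiv> trop_plus (sawtooth_num n) (sawtooth_den n) :: 'a::linordered_field trop_poly"
  shows "2 ^ n \<le> card {a. trop_root r a}"
proof -
  have eq_iff: "trop_eval (sawtooth_num n) x = trop_eval (sawtooth_den n) x \<longleftrightarrow> (tent ^^ n) x = 0"
    for x :: 'a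
    using eval_sawtooth[of n x] by (auto simp: field_simps)
  have root: "trop_root r z" if "(tent ^^ n) z = 0" for z
    unfolding r_def by (rule root_of_trop_plus) (simp_all add: eq_iff finite_tent_zeros that)
  obtain Z :: "'a set" where "card Z = 2 ^ n" "\<forall>z \<in> Z. (tent ^^ n) z = 0"
    using card_tent_zeros by blast
  then show ?thesis
    using root card_mono[OF finite_roots[of r], of Z] by auto
qed

section \<open>Circuits from straight-line programs\<close>

text \<open>A straight-line program is represented by the list of the polynomials it computes.\<close>

inductive straight_line :: "'a::linordered_field trop_poly list \<Rightarrow> bool" where
  Nil: "straight_line []"
| var: "straight_line ps \<Longrightarrow> straight_line (ps @ [trop_var])"
| const: "straight_line ps \<Longrightarrow> straight_line (ps @ [trop_const c])"
| plus: "straight_line ps \<Longrightarrow> p \<in> set ps \<Longrightarrow> q \<in> set ps \<Longrightarrow> straight_line (ps @ [trop_plus p q])"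
| times: "straight_line ps \<Longrightarrow> p \<in> set ps \<Longrightarrow> q \<in> set ps \<Longrightarrow> straight_line (ps @ [trop_times p q])"

text \<open>What remains of a program when each entry is described in terms of the positions of its
  operands. The label is tied to the operation here so that a choice function for \<open>(l, j, k)\<close>
  is already a circuit.\<close>

definition gate_spec ::
  "'a::linordered_field trop_poly list \<Rightarrow> nat \<Rightarrow> 'a gate_label \<Rightarrow> nat \<Rightarrow> nat \<Rightarrow> bool" where
  "gate_spec ps v l j k \<longleftrightarrow> (case l of
      Var \<Rightarrow> ps ! v = trop_var
    | Const c \<Rightarrow> ps ! v = trop_const c
    | Plus \<Rightarrow> j < v \<and> k < v \<and> ps ! v = trop_plus (ps ! j) (ps ! k)
    | Times \<Rightarrow> j < v \<and> k < v \<and> ps ! v = trop_times (ps ! j) (ps ! k))"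

lemma gate_spec_append: "v < length ps \<Longrightarrow> gate_spec (ps @ qs) v l j k = gate_spec ps v l j k"
  by (auto simp: gate_spec_def nth_append split: gate_label.splits)

lemma straight_line_gates:
  "straight_line ps \<Longrightarrow> v < length ps \<Longrightarrow> \<exists>l j k. gate_spec ps v l j k"
proof (induction arbitrary: v rule: straight_line.induct)
  case Nil
  then show ?case by simp
next
  case (var ps)
  have "gate_spec (ps @ [trop_var]) (length ps) Var 0 0"
    by (simp add: gate_spec_def)
  with var show ?case
    by (metis gate_spec_append length_append_singleton less_antisym)
next
  case (const ps c)
  have "gate_spec (ps @ [trop_const c]) (length ps) (Const c) 0 0"
    by (simp add: gate_spec_def)
  with const show ?case
    by (metis gate_spec_append length_append_singleton less_antisym)
next
  case (plus ps p q)
  then obtain j k where "j < length ps" "ps ! j = p" "k < length ps" "ps ! k = q"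
    by (auto simp: in_set_conv_nth)
  then have "gate_spec (ps @ [trop_plus p q]) (length ps) Plus j k"
    by (simp add: gate_spec_def nth_append)
  with plus show ?case
    by (metis gate_spec_append length_append_singleton less_antisym)
next
  case (times ps p q)
  then obtain j k where "j < length ps" "ps ! j = p" "k < length ps" "ps ! k = q"
    by (auto simp: in_set_conv_nth)
  then have "gate_spec (ps @ [trop_times p q]) (length ps) Times j k"
    by (simp add: gate_spec_def nth_append)
  with times show ?case
    by (metis gate_spec_append length_append_singleton less_antisym)
qed

text \<open>The gates are the positions in the program. The two arcs into gate \<open>v\<close> are numbered
  \<open>2 v\<close> and \<open>2 v + 1\<close>, which keeps them distinct even when both operands are the same gate;
  acyclicity holds because arcs lead from smaller to larger positions.\<close>

lemma straight_line_computable: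
  fixes ps :: "'a::linordered_field trop_poly list"
  assumes sl: "straight_line (ps @ [p])"
  shows "computable_in_size p (Suc (length ps))"
proof -
  let ?qs = "ps @ [p]" and ?m = "length ps"
  have "\<forall>v. \<exists>l j k. v \<le> ?m \<longrightarrow> gate_spec ?qs v l j k"
    using straight_line_gates[OF sl] by (metis le_imp_less_Suc length_append_singleton)
  then obtain lab lft rgt where spec: "\<And>v. v \<le> ?m \<Longrightarrow> gate_spec ?qs v (lab v) (lft v) (rgt v)"
    by metis
  define inner where "inner v \<longleftrightarrow> v \<le> ?m \<and> (lab v = Plus \<or> lab v = Times)" for v
  define G :: "(nat, nat) pre_digraph" where
    "G = \<lparr>verts = {..?m}, arcs = {e. inner (e div 2)},
      tail = (\<lambda>e. if even e then lft (e div 2) else rgt (e div 2)), head = (\<lambda>e. e div 2)\<rparr>"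
  define C :: "('a, nat, nat) circuit" where
    "C = \<lparr>graph = G, label = lab, out = ?m\<rparr>"
  have operands: "lft v < v" "rgt v < v" if "inner v" for v
    using that spec[of v] by (auto simp: inner_def gate_spec_def)
  have in_arcs: "in_arcs G v = (if inner v then {2 * v, 2 * v + 1} else {})" for v
  proof -
    have "e div 2 = v \<longleftrightarrow> e = 2 * v \<or> e = 2 * v + 1" for e by presburger
    then show ?thesis by (auto simp: in_arcs_def G_def)
  qed
  have tail_less: "tail G e < head G e" if "e \<in> arcs G" for e
    using that operands by (auto simp: G_def)
  have "trop_circuit C"
  proof (rule trop_circuit.intro)
    show "fin_digraph (graph C)"
    proof
      fix e assume e: "e \<in> arcs (graph C)"
      then show "head (graph C) e \<in> verts (graph C)"
        by (simp add: C_def G_def inner_def)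
      with tail_less[of e] e show "tail (graph C) e \<in> verts (graph C)"
        by (simp add: C_def G_def)
    next
      show "finite (verts (graph C))"
        by (simp add: C_def G_def)
      have "arcs G \<subseteq> {..2 * ?m + 1}"
        by (auto simp: G_def inner_def)
      then show "finite (arcs (graph C))"
        unfolding C_def by (simp add: finite_subset)
    qed
    have "arcs_ends G \<subseteq> less_than"
      using tail_less by (auto simp: arcs_ends_def arc_to_ends_def)
    then show "acyclic (arcs_ends (graph C))"
      using acyclic_subset[OF wf_acyclic[OF wf_less_than]] by (simp add: C_def)
    show "out C \<in> verts (graph C)"
      by (simp add: C_def G_def)
  next
    fix v assume "v \<in> verts (graph C)"
    then have "v \<le> ?m"
      by (simp add: C_def G_def)
    then show "in_degree (graph C) v = 0 \<and> (label C v = Var \<or> (\<exists>c. label C v = Const c)) \<or>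
        in_degree (graph C) v = 2 \<and> (label C v = Plus \<or> label C v = Times)"
      by (cases "lab v") (auto simp: C_def in_degree_def in_arcs inner_def)
  qed
  moreover have "circuit_size C \<le> Suc ?m"
    by (simp add: circuit_size_def C_def G_def)
  moreover have "gate_computes C v (?qs ! v)" if "v \<le> ?m" for v
    using that
  proof (induction v rule: less_induct)
    case (less v)
    have v: "v \<in> verts (graph C)"
      using less.prems by (simp add: C_def G_def)
    have inner: "in_arcs (graph C) v = {2 * v, 2 * v + 1}"
      "gate_computes C (tail (graph C) (2 * v)) (?qs ! lft v)"
      "gate_computes C (tail (graph C) (2 * v + 1)) (?qs ! rgt v)" if "inner v"
    proof -
      show "in_arcs (graph C) v = {2 * v, 2 * v + 1}"
        using that by (simp add: C_def in_arcs)
      have "tail (graph C) (2 * v) = lft v" "tail (graph C) (2 * v + 1) = rgt v"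
        by (simp_all add: C_def G_def)
      then show "gate_computes C (tail (graph C) (2 * v)) (?qs ! lft v)"
        "gate_computes C (tail (graph C) (2 * v + 1)) (?qs ! rgt v)"
        using operands[OF that] less by simp_all
    qed
    have l: "label C v = lab v"
      by (simp add: C_def)
    show ?case
    proof (cases "lab v")
      case Var
      then show ?thesis
        using spec[OF less.prems] gate_computes.var[OF v] l by (simp add: gate_spec_def)
    next
      case (Const c)
      then show ?thesis
        using spec[OF less.prems] gate_computes.const[OF v] l by (simp add: gate_spec_def)
    next
      case Plus
      then have "inner v" using less.prems by (simp add: inner_def)
      from gate_computes.plus[OF v _ inner(1)[OF this] _ inner(2,3)[OF this]] show ?thesis
        using Plus l spec[OF less.prems] by (simp add: gate_spec_def)
    next
      case Times
      then have "inner v" using less.prems by (simp add: inner_def)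
      from gate_computes.times[OF v _ inner(1)[OF this] _ inner(2,3)[OF this]] show ?thesis
        using Times l spec[OF less.prems] by (simp add: gate_spec_def)
    qed
  qed
  from this[of ?m] have "computes C p"
    by (simp add: computes_def C_def)
  ultimately show ?thesis
    unfolding computable_in_size_def by blast
qed

section \<open>The size of the sawtooth\<close>

text \<open>Two entries for the initial fraction and five for each step; the sum
  \<^term>\<open>trop_plus (sawtooth_num n) (sawtooth_den n)\<close> is computed once and squared.\<close>

lemma sawtooth_program:
  "\<exists>ps :: 'a::linordered_field trop_poly list. straight_line ps \<and> length ps = 5 * n + 2 \<and>
    sawtooth_num n \<in> set ps \<and> sawtooth_den n \<in> set ps"
proof (induction n)
  case 0
  have "straight_line ([] @ [trop_var :: 'a trop_poly] @ [trop_const 0])"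
    using straight_line.const[OF straight_line.var[OF straight_line.Nil], of 0] by simp
  then show ?case
    by (intro exI[of _ "[trop_var, trop_const 0]"]) simp
next
  case (Suc n)
  let ?A = "sawtooth_num n :: 'a trop_poly" and ?B = "sawtooth_den n :: 'a trop_poly"
  let ?c = "trop_const (1 / 2 ^ Suc n) :: 'a trop_poly"
  from Suc obtain ps where ps: "straight_line ps" "length ps = 5 * n + 2"
    "?A \<in> set ps" "?B \<in> set ps" by blast
  define ps1 where "ps1 = ps @ [trop_plus ?A ?B]"
  define ps2 where "ps2 = ps1 @ [trop_times ?A ?B]"
  define ps3 where "ps3 = ps2 @ [?c]"
  define ps4 where "ps4 = ps3 @ [sawtooth_num (Suc n)]"
  define ps5 where "ps5 = ps4 @ [sawtooth_den (Suc n)]"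
  have "straight_line ps1"
    unfolding ps1_def using ps by (intro straight_line.plus)
  then have "straight_line ps2"
    unfolding ps2_def using ps by (intro straight_line.times) (simp_all add: ps1_def)
  then have "straight_line ps3"
    unfolding ps3_def by (rule straight_line.const)
  then have "straight_line ps4"
    unfolding ps4_def sawtooth_num.simps
    by (intro straight_line.times) (simp_all add: ps1_def ps2_def ps3_def)
  then have "straight_line ps5"
    unfolding ps5_def sawtooth_den.simps
    by (intro straight_line.times) (simp_all add: ps2_def ps3_def ps4_def)
  moreover have "length ps5 = 5 * Suc n + 2"
    using ps(2) by (simp add: ps1_def ps2_def ps3_def ps4_def ps5_def)
  moreover have "sawtooth_num (Suc n) \<in> set ps5" "sawtooth_den (Suc n) \<in> set ps5"
    by (simp_all add: ps4_def ps5_def del: sawtooth_num.simps sawtooth_den.simps)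
  ultimately show ?case by blast
qed

lemma sawtooth_computable:
  assumes "n \<ge> 1"
  shows "computable_in_size (trop_plus (sawtooth_num n) (sawtooth_den n) :: 'a::linordered_field trop_poly) (8 * n)"
proof -
  obtain ps :: "'a trop_poly list" where ps: "straight_line ps" "length ps = 5 * n + 2"
    "sawtooth_num n \<in> set ps" "sawtooth_den n \<in> set ps"
    using sawtooth_program by blast
  then have "computable_in_size (trop_plus (sawtooth_num n) (sawtooth_den n) :: 'a trop_poly) (5 * n + 3)"
    using straight_line_computable[OF straight_line.plus[OF ps(1,3,4)]] by (simp add: numeral_3_eq_3)
  moreover have "5 * n + 3 \<le> 8 * n"
    using assms by simp
  ultimately show ?thesis
    unfolding computable_in_size_def by (meson order_trans)
qed

theorem theorem36:
  shows "\<exists>K :: nat.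
    (\<exists>r :: nat \<Rightarrow> real trop_poly. \<forall>n \<ge> 1.
       computable_in_size (r n) (K * n) \<and> 2 ^ n \<le> card {a. trop_root (r n) a}) \<and>
    (\<exists>r :: nat \<Rightarrow> rat trop_poly. \<forall>n \<ge> 1.
       computable_in_size (r n) (K * n) \<and> 2 ^ n \<le> card {a. trop_root (r n) a})"
proof (intro exI[of _ 8] conjI)
  let ?r = "\<lambda>n. trop_plus (sawtooth_num n) (sawtooth_den n)"
  show "\<exists>r :: nat \<Rightarrow> real trop_poly. \<forall>n \<ge> 1.
      computable_in_size (r n) (8 * n) \<and> 2 ^ n \<le> card {a. trop_root (r n) a}"
    by (intro exI[of _ ?r]) (simp add: sawtooth_computable card_sawtooth_roots)
  show "\<exists>r :: nat \<Rightarrow> rat trop_poly. \<forall>n \<ge> 1.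
      computable_in_size (r n) (8 * n) \<and> 2 ^ n \<le> card {a. trop_root (r n) a}"
    by (intro exI[of _ ?r]) (simp add: sawtooth_computable card_sawtooth_roots)
qed

end
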